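(* Let $G_1=(V_1,E_1)$ be an $n_1$-vertex graph which is $d_1$-regular and let $G_2=(V_2,E_2)$ be a $d_1$-vertex graph which is $d_2$-regular. Then (for every choice of labeling in the definition of the zigzag product $G_1 ⓩ G_2$) every kernel $K:X\times X\to[0,\infty)$ satisfies $$\gamma_+\left(G_1 ⓩ G_2,K\right)\le\gamma_+(G_1,K)\cdot\gamma_+(G_2,K)^2.$$
   Context: Graphs are finite and undirected, with self loops and multiple edges allowed: a graph $G=(V,E)$ consists of a finite set $V$ and nonnegative integers $E(u,v)=E(v,u)$ for $(u,v)\in V\times V$. The degree of $u$ is $\sum_{v}E(u,v)$ (each self loop contributes $1$); $G$ is $d$-regular if all degrees equal $d$; its normalized adjacency matrix is $A_G=(E(u,v)/d)_{u,v}$. A kernel on a set $X$ is a symmetric function $K:X\times X\to[0,\infty)$. For an $n\times n$ symmetric stochastic matrix $A=(a_{ij})$, $\gamma_+(A,K)\in[0,\infty]$ is the infimum over those $\gamma_+>0$ such that for all $x_1,\ldots,x_n,y_1,\ldots,y_n\in X$, $$\frac1{n^2}\sum_{i,j=1}^nK(x_i,y_j)\le\frac{\gamma_+}{n}\sum_{i,j=1}^na_{ij}K(x_i,y_j)$$ ($\infty$ if there is no finite such $\gamma_+$). For a regular graph $G$, $\gamma_+(G,K)=\gamma_+(A_G,K)$. Zigzag product. Let $G_1$ be $d_1$-regular on $V_1$ and let $G_2$ be $d_2$-regular on $V_2$ with $|V_2|=d_1$. Regard $E_1$ as a multiset of ordered pairs containing $E_1(u,v)$ copies of $(u,v)$,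 and fix a pairing $e\mapsto\bar e$ (an involution) of the copies of $(u,v)$ with the copies of $(v,u)$. For every $u\in V_1$ fix a bijection $\pi_u$ from the $d_1$ edge copies of the form $(u,\cdot)$ onto $V_2$ (the labeling). The zigzag product $G_1 ⓩ G_2$ is the $d_2^2$-regular graph with vertex set $V_1\times V_2$ in which the number of edges joining $(u,a)$ and $(v,b)$ is $$\sum_{e\text{ a copy of }(u,v)\text{ in }E_1}E_2\big(a,\pi_u(e)\big)\,E_2\big(b,\pi_v(\bar e)\big).$$ *)

theory Defs
  imports Complex_Main "HOL-Library.Extended_Nonnegative_Real"
begin

record 'a mgraph =
  verts :: "'a set"
  mult :: "'a \<Rightarrow> 'a \<Rightarrow> nat"

definition multigraph :: "'a mgraph \<Rightarrow> bool" where
  "multigraph G \<longleftrightarrow>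
     finite (verts G) \<and> (\<forall>u\<in>verts G. \<forall>v\<in>verts G. mult G u v = mult G v u)"

definition degree :: "'a mgraph \<Rightarrow> 'a \<Rightarrow> nat" where
  "degree G u = (\<Sum>v\<in>verts G. mult G u v)"

definition regular :: "nat \<Rightarrow> 'a mgraph \<Rightarrow> bool" where
  "regular d G \<longleftrightarrow> (\<forall>u\<in>verts G. degree G u = d)"

text \<open>
  Only used for regular graphs, where \<open>degree G u\<close> is the common degree; this avoids
  carrying the degree as an extra argument.
\<close>

definition norm_adj :: "'a mgraph \<Rightarrow> 'a \<Rightarrow> 'a \<Rightarrow> real" where
  "norm_adj G u v = real (mult G u v) / real (degree G u)"

definition kernel_on :: "'x set \<Rightarrow> ('x \<Rightarrow> 'x \<Rightarrow> real) \<Rightarrow> bool" where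
  "kernel_on X K \<longleftrightarrow> (\<forall>x\<in>X. \<forall>y\<in>X. 0 \<le> K x y \<and> K x y = K y x)"

text \<open>
  The matrix \<open>A\<close> is indexed by the finite set \<open>I\<close> rather than by \<open>{1..n}\<close>, with \<open>n = card I\<close>.
  The infimum of the empty set is \<open>\<infinity>\<close> in \<^typ>\<open>ennreal\<close>, as required.
\<close>

definition gamma_plus ::
    "'i set \<Rightarrow> ('i \<Rightarrow> 'i \<Rightarrow> real) \<Rightarrow> 'x set \<Rightarrow> ('x \<Rightarrow> 'x \<Rightarrow> real) \<Rightarrow> ennreal" where
  "gamma_plus I A X K = Inf (ennreal ` {\<gamma>::real. 0 < \<gamma> \<and>
     (\<forall>x y. x ` I \<subseteq> X \<longrightarrow> y ` I \<subseteq> X \<longrightarrow>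
        1 / (real (card I))\<^sup>2 * (\<Sum>i\<in>I. \<Sum>j\<in>I. K (x i) (y j))
        \<le> \<gamma> / real (card I) * (\<Sum>i\<in>I. \<Sum>j\<in>I. A i j * K (x i) (y j)))})"

definition graph_gamma_plus ::
    "'a mgraph \<Rightarrow> 'x set \<Rightarrow> ('x \<Rightarrow> 'x \<Rightarrow> real) \<Rightarrow> ennreal" where
  "graph_gamma_plus G X K = gamma_plus (verts G) (norm_adj G) X K"

text \<open>
  The triple \<open>(u, v, k)\<close> is the \<open>k\<close>-th copy of the ordered pair \<open>(u, v)\<close>.
\<close>

definition edge_copies :: "'a mgraph \<Rightarrow> 'a \<Rightarrow> 'a \<Rightarrow> ('a \<times> 'a \<times> nat) set" where
  "edge_copies G u v = {(u, v, k) | k. k < mult G u v}"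

definition edges_from :: "'a mgraph \<Rightarrow> 'a \<Rightarrow> ('a \<times> 'a \<times> nat) set" where
  "edges_from G u = (\<Union>v\<in>verts G. edge_copies G u v)"

definition edge_pairing ::
    "'a mgraph \<Rightarrow> ('a \<times> 'a \<times> nat \<Rightarrow> 'a \<times> 'a \<times> nat) \<Rightarrow> bool" where
  "edge_pairing G bar \<longleftrightarrow>
     (\<forall>u\<in>verts G. \<forall>v\<in>verts G. \<forall>e\<in>edge_copies G u v.
        bar e \<in> edge_copies G v u \<and> bar (bar e) = e)"

definition labeling ::
    "'a mgraph \<Rightarrow> 'b set \<Rightarrow> ('a \<Rightarrow> 'a \<times> 'a \<times> nat \<Rightarrow> 'b) \<Rightarrow> bool" where
  "labeling G W lab \<longleftrightarrow> (\<forall>u\<in>verts G. bij_betw (lab u) (edges_from G u) W)"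

definition zigzag ::
    "'a mgraph \<Rightarrow> 'b mgraph \<Rightarrow> ('a \<times> 'a \<times> nat \<Rightarrow> 'a \<times> 'a \<times> nat) \<Rightarrow>
     ('a \<Rightarrow> 'a \<times> 'a \<times> nat \<Rightarrow> 'b) \<Rightarrow> ('a \<times> 'b) mgraph" where
  "zigzag G1 G2 bar lab =
     \<lparr>verts = verts G1 \<times> verts G2,
      mult = (\<lambda>(u, a) (v, b).
        \<Sum>e\<in>edge_copies G1 u v. mult G2 a (lab u e) * mult G2 b (lab v (bar e)))\<rparr>"

lemma finite_edge_copies [simp]: "finite (edge_copies G u v)"
proof -
  have "edge_copies G u v = (\<lambda>k. (u, v, k)) ` {..<mult G u v}"
    by (auto simp: edge_copies_def)
  then show ?thesis by simp
qed

lemma edge_pairing_bij_betw: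
  assumes "edge_pairing G bar" "u \<in> verts G" "v \<in> verts G"
  shows "bij_betw bar (edge_copies G u v) (edge_copies G v u)"
  using assms by (intro bij_betw_byWitness[where f' = bar]) (auto simp: edge_pairing_def)

lemma multigraph_zigzag:
  assumes "multigraph G1" "multigraph G2" "edge_pairing G1 bar"
  shows "multigraph (zigzag G1 G2 bar lab)"
proof -
  have "(\<Sum>e\<in>edge_copies G1 u v. mult G2 a (lab u e) * mult G2 b (lab v (bar e)))
      = (\<Sum>e\<in>edge_copies G1 v u. mult G2 b (lab v e) * mult G2 a (lab u (bar e)))"
    if uv: "u \<in> verts G1" "v \<in> verts G1" for u v a b
  proof -
    have "(\<Sum>e\<in>edge_copies G1 v u. mult G2 b (lab v e) * mult G2 a (lab u (bar e)))
        = (\<Sum>e\<in>edge_copies G1 u v. mult G2 b (lab v (bar e)) * mult G2 a (lab u (bar (bar e))))"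
      by (rule sum.reindex_bij_betw[OF edge_pairing_bij_betw[OF assms(3) uv], symmetric])
    also have "\<dots> = (\<Sum>e\<in>edge_copies G1 u v. mult G2 a (lab u e) * mult G2 b (lab v (bar e)))"
      using assms(3) uv by (intro sum.cong) (auto simp: edge_pairing_def)
    finally show ?thesis by simp
  qed
  with assms show ?thesis
    by (auto simp: multigraph_def zigzag_def)
qed

lemma regular_zigzag:
  assumes G1: "multigraph G1"
    and G2: "multigraph G2" "regular d2 G2"
    and bar: "edge_pairing G1 bar" and lab: "labeling G1 (verts G2) lab"
  shows "regular (d2\<^sup>2) (zigzag G1 G2 bar lab)"
proof -
  have fin: "finite (verts G1)" "finite (verts G2)"
    using G1 G2 by (auto simp: multigraph_def)
  have lab_in: "lab u e \<in> verts G2"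
    if "u \<in> verts G1" "v \<in> verts G1" "e \<in> edge_copies G1 u v" for u v e
    using lab that unfolding labeling_def edges_from_def bij_betw_def by blast
  have deg: "(\<Sum>b\<in>verts G2. mult G2 a b) = d2" if "a \<in> verts G2" for a
    using G2 that by (simp add: regular_def degree_def)
  have deg': "(\<Sum>b\<in>verts G2. mult G2 b a) = d2" if "a \<in> verts G2" for a
    using G2(1) that deg[OF that] by (simp add: multigraph_def)
  have "degree (zigzag G1 G2 bar lab) (u, a) = d2\<^sup>2"
    if ua: "u \<in> verts G1" "a \<in> verts G2" for u a
  proof -
    have "degree (zigzag G1 G2 bar lab) (u, a)
      = (\<Sum>v\<in>verts G1. \<Sum>b\<in>verts G2. \<Sum>e\<in>edge_copies G1 u v.
           mult G2 a (lab u e) * mult G2 b (lab v (bar e)))"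
      by (subst sum.cartesian_product) (simp add: degree_def zigzag_def)
    also have "\<dots> = (\<Sum>v\<in>verts G1. \<Sum>e\<in>edge_copies G1 u v. mult G2 a (lab u e) * d2)"
    proof (rule sum.cong[OF refl])
      fix v assume v: "v \<in> verts G1"
      have "(\<Sum>b\<in>verts G2. \<Sum>e\<in>edge_copies G1 u v. mult G2 a (lab u e) * mult G2 b (lab v (bar e)))
        = (\<Sum>e\<in>edge_copies G1 u v. mult G2 a (lab u e) * (\<Sum>b\<in>verts G2. mult G2 b (lab v (bar e))))"
        by (subst sum.swap) (simp add: sum_distrib_left)
      also have "\<dots> = (\<Sum>e\<in>edge_copies G1 u v. mult G2 a (lab u e) * d2)"
      proof (rule sum.cong[OF refl])
        fix e assume e: "e \<in> edge_copies G1 u v"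
        have "bar e \<in> edge_copies G1 v u"
          using bar ua v e by (auto simp: edge_pairing_def)
        then show "mult G2 a (lab u e) * (\<Sum>b\<in>verts G2. mult G2 b (lab v (bar e)))
            = mult G2 a (lab u e) * d2"
          using deg'[OF lab_in[OF v ua(1)]] by simp
      qed
      finally show "(\<Sum>b\<in>verts G2. \<Sum>e\<in>edge_copies G1 u v.
          mult G2 a (lab u e) * mult G2 b (lab v (bar e)))
        = (\<Sum>e\<in>edge_copies G1 u v. mult G2 a (lab u e) * d2)" .
    qed
    also have "\<dots> = (\<Sum>e\<in>edges_from G1 u. mult G2 a (lab u e) * d2)"
      unfolding edges_from_def
      by (rule sum.UNION_disjoint[symmetric]) (use fin in \<open>auto simp: edge_copies_def\<close>)
    also have "\<dots> = (\<Sum>c\<in>verts G2. mult G2 a c * d2)"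
      using lab ua by (intro sum.reindex_bij_betw) (auto simp: labeling_def)
    also have "\<dots> = d2\<^sup>2"
      using deg[OF ua(2)] by (simp add: sum_distrib_right[symmetric] power2_eq_square)
    finally show ?thesis .
  qed
  then show ?thesis
    by (auto simp: regular_def zigzag_def)
qed

end

theory Submission
  imports Defs
begin

text \<open>
  Averaging the inequality for \<open>G1\<close> over all \<open>a, b\<close> bounds the mean of
  \<open>K (x (u, a)) (y (v, b))\<close> by its mean over edges \<open>e\<close> from \<open>u\<close> to \<open>v\<close> and arbitrary
  \<open>a, b\<close>. As \<open>e\<close> runs through the edges at \<open>u\<close>, its label runs through the vertices of
  \<open>G2\<close>, so the inequality for \<open>G2\<close> replaces a free \<open>a\<close> by a neighbour of the label of \<open>e\<close>
  at \<open>u\<close>. Applying it once more at the other end \<open>v\<close>, with the edges reversed, replaces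
  \<open>b\<close> by a neighbour of the label at \<open>v\<close>, which gives the mean over edges of the zigzag
  product.
\<close>

section \<open>Admissible constants and the vanishing of \<open>gamma_plus\<close>\<close>

text \<open>The inequality inside \<open>gamma_plus\<close> multiplied by the square of
  \<open>card I\<close>. The combinatorial estimates are made for such real constants; infima in
  \<open>ennreal\<close> are taken only at the end.\<close>

definition poincare_const ::
    "'i set \<Rightarrow> ('i \<Rightarrow> 'i \<Rightarrow> real) \<Rightarrow> 'x set \<Rightarrow> ('x \<Rightarrow> 'x \<Rightarrow> real) \<Rightarrow> real \<Rightarrow> bool" where
  "poincare_const I A X K \<gamma> \<longleftrightarrow> 0 < \<gamma> \<and>
     (\<forall>x y. x ` I \<subseteq> X \<longrightarrow> y ` I \<subseteq> X \<longrightarrow>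
        (\<Sum>i\<in>I. \<Sum>j\<in>I. K (x i) (y j))
        \<le> \<gamma> * real (card I) * (\<Sum>i\<in>I. \<Sum>j\<in>I. A i j * K (x i) (y j)))"

lemma poincare_constD:
  assumes "poincare_const I A X K \<gamma>" "\<And>i. i \<in> I \<Longrightarrow> x i \<in> X" "\<And>i. i \<in> I \<Longrightarrow> y i \<in> X"
  shows "(\<Sum>i\<in>I. \<Sum>j\<in>I. K (x i) (y j))
    \<le> \<gamma> * real (card I) * (\<Sum>i\<in>I. \<Sum>j\<in>I. A i j * K (x i) (y j))"
  using assms by (auto simp: poincare_const_def image_subset_iff)

lemma poincare_const_pos: "poincare_const I A X K \<gamma> \<Longrightarrow> 0 < \<gamma>"
  by (simp add: poincare_const_def)

text \<open>Clearing denominators needs a nonempty index set; for the empty one both sums vanish, so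
  every positive constant is admissible in either form.\<close>

lemma gamma_plus_eq_Inf:
  assumes "finite I"
  shows "gamma_plus I A X K = Inf (ennreal ` {\<gamma>. poincare_const I A X K \<gamma>})"
proof (cases "I = {}")
  case True
  then show ?thesis by (simp add: gamma_plus_def poincare_const_def)
next
  case False
  with assms have n: "real (card I) > 0" by (simp add: card_gt_0_iff)
  have "1 / n\<^sup>2 * s \<le> \<gamma> / n * t \<longleftrightarrow> s \<le> \<gamma> * n * t" if "n > 0" for n s \<gamma> t :: real
    using that by (simp add: field_simps power2_eq_square)
  note eq = this[OF n]
  show ?thesis
    unfolding gamma_plus_def poincare_const_def eq ..
qed

lemma gamma_plus_le:
  assumes "finite I" "poincare_const I A X K \<gamma>"
  shows "gamma_plus I A X K \<le> ennreal \<gamma>"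
  unfolding gamma_plus_eq_Inf[OF assms(1)] using assms(2) by (intro Inf_lower imageI CollectI)

lemma gamma_plus_eq_0I:
  assumes "finite I" and "I = {} \<or> (\<forall>x\<in>X. \<forall>y\<in>X. K x y = 0)"
  shows "gamma_plus I A X K = 0"
proof -
  have le: "gamma_plus I A X K \<le> ennreal \<gamma>" if "\<gamma> > 0" for \<gamma>
  proof (rule gamma_plus_le[OF assms(1)], unfold poincare_const_def, intro conjI allI impI)
    fix x y assume x: "x ` I \<subseteq> X" and y: "y ` I \<subseteq> X"
    have 0: "K (x i) (y j) = 0" if "i \<in> I" "j \<in> I" for i j
      using assms(2) x y that by blast
    show "(\<Sum>i\<in>I. \<Sum>j\<in>I. K (x i) (y j))
        \<le> \<gamma> * real (card I) * (\<Sum>i\<in>I. \<Sum>j\<in>I. A i j * K (x i) (y j))"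
      by (simp add: 0)
  qed (rule that)
  have "gamma_plus I A X K \<le> 0"
  proof (rule ennreal_le_epsilon)
    show "gamma_plus I A X K \<le> 0 + ennreal e" if "0 < e" for e
      using le[OF that] by simp
  qed
  then show ?thesis by simp
qed

text \<open>Testing constant maps at a pair with \<open>K x y > 0\<close> bounds every admissible
  constant away from 0. With \<open>gamma_plus_eq_0I\<close> this makes vanishing a property of
  \<open>I\<close> and \<open>K\<close> alone, so that it carries over from a factor to the zigzag
  product.\<close>

lemma gamma_plus_eq_0D:
  assumes fin: "finite I" and K: "kernel_on X K" and "gamma_plus I A X K = 0"
  shows "I = {} \<or> (\<forall>x\<in>X. \<forall>y\<in>X. K x y = 0)"
proof (rule ccontr)
  assume neg: "\<not> (I = {} \<or> (\<forall>x\<in>X. \<forall>y\<in>X. K x y = 0))"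
  then obtain x y where xy: "x \<in> X" "y \<in> X" "K x y \<noteq> 0" by blast
  with K have k: "K x y > 0" unfolding kernel_on_def by (metis less_eq_real_def)
  define n where "n = real (card I)"
  have n: "n > 0" using fin neg by (simp add: n_def card_gt_0_iff)
  define C where "C = (\<Sum>i\<in>I. \<Sum>j\<in>I. A i j)"
  \<comment> \<open>Constant maps give \<open>n \<le> \<gamma> * C\<close>; replacing
    \<open>C\<close> by \<open>\<bar>C\<bar> + 1\<close> avoids a case distinction on its
    sign.\<close>
  have "ennreal (n / (\<bar>C\<bar> + 1)) \<le> ennreal \<gamma>" if p: "poincare_const I A X K \<gamma>" for \<gamma>
  proof -
    have "n * (n * K x y) \<le> \<gamma> * n * (C * K x y)"
      using poincare_constD[OF p, of "\<lambda>_. x" "\<lambda>_. y"] xy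
      by (simp add: C_def n_def sum_distrib_right)
    then have "(n * K x y) * n \<le> (n * K x y) * (\<gamma> * C)" by (simp add: mult_ac)
    then have "n \<le> \<gamma> * C" using n k by simp
    also have "\<dots> \<le> \<gamma> * (\<bar>C\<bar> + 1)"
      using poincare_const_pos[OF p] by (intro mult_left_mono) auto
    finally show ?thesis by (intro ennreal_leI) (simp add: pos_divide_le_eq add_pos_nonneg)
  qed
  then have "ennreal (n / (\<bar>C\<bar> + 1)) \<le> gamma_plus I A X K"
    by (auto simp: gamma_plus_eq_Inf[OF fin] intro!: Inf_greatest)
  moreover have "n / (\<bar>C\<bar> + 1) > 0" using n by simp
  ultimately show False using assms(3) by (simp add: ennreal_eq_0_iff flip: not_less)
qed

section \<open>Infima of products, and weighted sums as enumerations\<close>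

text \<open>For \<open>c\<close> positive and finite one divides by \<open>c\<close>. The convention
  that 0 times \<open>top\<close> is 0 is what can go wrong otherwise: \<open>c = 0\<close> with
  \<open>A\<close> empty, or \<open>c = top\<close> with \<open>Inf A = 0\<close>.\<close>

lemma le_Inf_mult_ennreal:
  fixes c x :: ennreal
  assumes le: "\<And>a. a \<in> A \<Longrightarrow> x \<le> a * c" and c: "c \<noteq> 0" "Inf A \<noteq> 0 \<or> c \<noteq> top"
  shows "x \<le> Inf A * c"
proof (cases "c = top")
  case True
  with c show ?thesis by (simp add: ennreal_mult_top)
next
  case False
  with c have c': "0 < c" "c < top" by (auto simp: less_top zero_less_iff_neq_zero)
  have "x / c \<le> Inf A"
    using le c c' by (intro Inf_greatest) (simp add: divide_le_posI_ennreal mult.commute)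
  then have "x / c * c \<le> Inf A * c" by (rule mult_right_mono) simp
  then show ?thesis using c' by (simp add: ennreal_divide_times mult_divide_eq_ennreal)
qed

text \<open>List each \<open>a\<close> with \<open>w a\<close> repetitions: the disjoint union
  \<open>Sigma\<close> has exactly \<open>d\<close> elements. This is used for the neighbours of a
  vertex of \<open>G2\<close>, counted with multiplicity.\<close>

lemma sum_nat_weights_as_enumeration:
  fixes w :: "'a \<Rightarrow> nat"
  assumes "finite A" "(\<Sum>a\<in>A. w a) = d"
  obtains \<nu> where "\<And>k. k < d \<Longrightarrow> \<nu> k \<in> A"
    and "\<And>g :: 'a \<Rightarrow> real. (\<Sum>a\<in>A. real (w a) * g a) = (\<Sum>k<d. g (\<nu> k))"
proof -
  let ?S = "Sigma A (\<lambda>a. {..<w a})"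
  have "finite ?S" "card ?S = d" using assms by auto
  then obtain h where h: "bij_betw h {..<d} ?S"
    using ex_bij_betw_nat_finite[of ?S] by (auto simp: atLeast0LessThan)
  show thesis
  proof (rule that)
    show "fst (h k) \<in> A" if "k < d" for k
      using bij_betwE[OF h] that by force
    fix g :: "'a \<Rightarrow> real"
    have "(\<Sum>k<d. g (fst (h k))) = (\<Sum>p\<in>?S. g (fst p))"
      by (rule sum.reindex_bij_betw[OF h])
    also have "\<dots> = (\<Sum>a\<in>A. \<Sum>k<w a. g a)"
      using assms by (subst sum.Sigma) (auto simp: case_prod_beta)
    finally show "(\<Sum>a\<in>A. real (w a) * g a) = (\<Sum>k<d. g (fst (h k)))" by simp
  qed
qed

section \<open>The inequality of the small graph along the edges at one vertex\<close>

locale labelled_graph =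
  fixes G1 :: "'a mgraph" and W :: "'b set" and lab :: "'a \<Rightarrow> 'a \<times> 'a \<times> nat \<Rightarrow> 'b"
  assumes finite_verts: "finite (verts G1)"
    and labeling: "labeling G1 W lab"
begin

lemma sum_edges_from:
  fixes f :: "'a \<times> 'a \<times> nat \<Rightarrow> 'c::comm_monoid_add"
  shows "(\<Sum>v\<in>verts G1. \<Sum>e\<in>edge_copies G1 u v. f e) = (\<Sum>e\<in>edges_from G1 u. f e)"
  unfolding edges_from_def
  by (rule sum.UNION_disjoint[symmetric]) (use finite_verts in \<open>auto simp: edge_copies_def\<close>)

lemma lab_in:
  "u \<in> verts G1 \<Longrightarrow> v \<in> verts G1 \<Longrightarrow> e \<in> edge_copies G1 u v \<Longrightarrow> lab u e \<in> W"
  using labeling by (force simp: labeling_def edges_from_def dest: bij_betwE)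

text \<open>The labeling at \<open>u\<close> identifies the edges at \<open>u\<close> with
  \<open>W\<close>, so a function \<open>f\<close> on these edges becomes a function on
  \<open>W\<close>, and the inequality on \<open>W\<close> can be pulled back.\<close>

lemma sum_edges_le:
  assumes pc: "poincare_const W A X K \<gamma>" and u: "u \<in> verts G1"
    and g: "\<And>a. a \<in> W \<Longrightarrow> g a \<in> X"
    and f: "\<And>v e. v \<in> verts G1 \<Longrightarrow> e \<in> edge_copies G1 u v \<Longrightarrow> f e \<in> X"
  shows "(\<Sum>v\<in>verts G1. \<Sum>e\<in>edge_copies G1 u v. \<Sum>a\<in>W. K (g a) (f e))
    \<le> \<gamma> * real (card W) *
       (\<Sum>v\<in>verts G1. \<Sum>e\<in>edge_copies G1 u v. \<Sum>a\<in>W. A a (lab u e) * K (g a) (f e))"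
proof -
  have bij: "bij_betw (lab u) (edges_from G1 u) W"
    using labeling u by (simp add: labeling_def)
  define h where "h = inv_into (edges_from G1 u) (lab u)"
  have h: "h (lab u e) = e" if "e \<in> edges_from G1 u" for e
    using bij that by (simp add: h_def bij_betw_def)
  have hX: "f (h c) \<in> X" if "c \<in> W" for c
  proof -
    have "h c \<in> edges_from G1 u"
      using bij that by (simp add: h_def bij_betw_def inv_into_into)
    then show ?thesis using f unfolding edges_from_def by blast
  qed
  \<comment> \<open>A general weight \<open>B\<close> serves both sides of the inequality: the
    constant 1 on the left and \<open>A\<close> on the right.\<close>
  have eq: "(\<Sum>v\<in>verts G1. \<Sum>e\<in>edge_copies G1 u v. \<Sum>a\<in>W. B a (lab u e) * K (g a) (f e))
      = (\<Sum>a\<in>W. \<Sum>c\<in>W. B a c * K (g a) (f (h c)))" for B :: "'b \<Rightarrow> 'b \<Rightarrow> real"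
  proof -
    have "(\<Sum>v\<in>verts G1. \<Sum>e\<in>edge_copies G1 u v. \<Sum>a\<in>W. B a (lab u e) * K (g a) (f e))
      = (\<Sum>e\<in>edges_from G1 u. \<Sum>a\<in>W. B a (lab u e) * K (g a) (f (h (lab u e))))"
      unfolding sum_edges_from by (simp add: h)
    also have "\<dots> = (\<Sum>c\<in>W. \<Sum>a\<in>W. B a c * K (g a) (f (h c)))"
      by (rule sum.reindex_bij_betw[OF bij])
    also have "\<dots> = (\<Sum>a\<in>W. \<Sum>c\<in>W. B a c * K (g a) (f (h c)))"
      by (rule sum.swap)
    finally show ?thesis .
  qed
  show ?thesis
    unfolding eq eq[of "\<lambda>_ _. 1", unfolded mult_1_left]
    using poincare_constD[OF pc, of g "\<lambda>c. f (h c)"] g hX by blast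
qed

end

section \<open>The inequality for the zigzag product\<close>

text \<open>The two applications of the inequality for \<open>G2\<close> carry separate constants
  \<open>\<gamma>2\<close> and \<open>\<gamma>3\<close>, so that the infimum can later be taken in
  each factor independently.\<close>

lemma poincare_const_zigzag:
  assumes G1: "multigraph G1" "regular (card (verts G2)) G1"
    and G2: "multigraph G2" "regular d2 G2"
    and bar: "edge_pairing G1 bar" and lab: "labeling G1 (verts G2) lab"
    and K: "kernel_on X K"
    and p1: "poincare_const (verts G1) (norm_adj G1) X K \<gamma>1"
    and p2: "poincare_const (verts G2) (norm_adj G2) X K \<gamma>2"
    and p3: "poincare_const (verts G2) (norm_adj G2) X K \<gamma>3"
  shows "poincare_const (verts (zigzag G1 G2 bar lab)) (norm_adj (zigzag G1 G2 bar lab)) X K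
    (\<gamma>1 * \<gamma>2 * \<gamma>3)"
proof -
  define Z where "Z = zigzag G1 G2 bar lab"
  define V1 where "V1 = verts G1"
  define V2 where "V2 = verts G2"
  define A where "A = norm_adj G2"
  define n1 where "n1 = real (card V1)"
  define d1 where "d1 = real (card V2)"
  have nonneg: "d1 \<ge> 0" "n1 \<ge> 0" by (simp_all add: d1_def n1_def)
  have fin: "finite V1" "finite V2"
    using G1 G2 by (auto simp: multigraph_def V1_def V2_def)
  interpret labelled_graph G1 V2 lab
    using G1 lab by unfold_locales (auto simp: multigraph_def V2_def)
  note sum_edges_le = sum_edges_le[folded V1_def d1_def]
  note lab_in = lab_in[folded V1_def]
  have pos: "\<gamma>1 > 0" "\<gamma>2 > 0" "\<gamma>3 > 0"
    using p1 p2 p3 by (auto simp: poincare_const_pos)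
  have bar_copies: "bij_betw bar (edge_copies G1 v u) (edge_copies G1 u v)"
    if "u \<in> V1" "v \<in> V1" for u v
    using edge_pairing_bij_betw[OF bar] that by (simp add: V1_def)
  have bar_bar: "bar (bar e) = e" if "u \<in> V1" "v \<in> V1" "e \<in> edge_copies G1 u v" for u v e
    using bar that by (auto simp: edge_pairing_def V1_def)
  have A1: "norm_adj G1 u v = real (mult G1 u v) / d1" if "u \<in> V1" for u v
    using G1 that by (simp add: norm_adj_def regular_def V1_def V2_def d1_def)
  have A2: "A a b = real (mult G2 a b) / real d2" if "a \<in> V2" for a b
    using G2 that by (simp add: norm_adj_def regular_def V2_def A_def)
  \<comment> \<open>The degree \<open>d2\<^sup>2\<close> of the product splits evenly between the
    two \<open>G2\<close>-steps of an edge, so each is normalized on its own.\<close>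
  have AZ: "norm_adj Z (u, a) (v, b)
      = (\<Sum>e\<in>edge_copies G1 u v. A a (lab u e) * A b (lab v (bar e)))"
    if "u \<in> V1" "v \<in> V1" "a \<in> V2" "b \<in> V2" for u v a b
  proof -
    have "degree Z (u, a) = d2\<^sup>2"
      using regular_zigzag[OF G1(1) G2 bar lab] that
      by (simp add: regular_def Z_def V1_def V2_def zigzag_def)
    then show ?thesis
      using that
      by (simp add: norm_adj_def Z_def zigzag_def A2 sum_divide_distrib power2_eq_square)
  qed
  have card_copies: "card (edge_copies G1 u v) = mult G1 u v" for u v
  proof -
    have "edge_copies G1 u v = (\<lambda>k. (u, v, k)) ` {..<mult G1 u v}"
      by (auto simp: edge_copies_def)
    then show ?thesis by (simp add: card_image inj_on_def)
  qed
  have ex: "\<exists>\<nu>. (\<forall>k<d2. \<nu> k \<in> V2) \<and>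
      (\<forall>g. (\<Sum>a\<in>V2. A a c * g a) = (\<Sum>k<d2. g (\<nu> k) / real d2))" if c: "c \<in> V2" for c
  proof -
    \<comment> \<open>Regularity controls the sum over the second argument; symmetry of
      \<open>mult\<close> transfers this to the first.\<close>
    have "(\<Sum>a\<in>V2. mult G2 a c) = d2"
      using G2 c by (auto simp: multigraph_def regular_def degree_def V2_def cong: sum.cong)
    from sum_nat_weights_as_enumeration[OF fin(2) this] obtain \<nu>
      where \<nu>: "\<And>k. k < d2 \<Longrightarrow> \<nu> k \<in> V2"
        "\<And>g :: 'b \<Rightarrow> real. (\<Sum>a\<in>V2. real (mult G2 a c) * g a) = (\<Sum>k<d2. g (\<nu> k))"
      by blast
    have "(\<Sum>a\<in>V2. A a c * g a) = (\<Sum>k<d2. g (\<nu> k) / real d2)" for g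
      using \<nu>(2)[of g] by (simp add: A2 flip: sum_divide_distrib)
    with \<nu>(1) show ?thesis by blast
  qed
  \<comment> \<open>The neighbours \<open>\<nu> c k\<close> of \<open>c\<close> turn the sum weighted by \<open>A a c\<close>, whose \<open>a\<close> depends on the edge,
    into \<open>d2\<close> single-valued choices, to each of which \<open>sum_edges_le\<close> applies.\<close>
  obtain \<nu> where \<nu>: "\<And>c k. c \<in> V2 \<Longrightarrow> k < d2 \<Longrightarrow> \<nu> c k \<in> V2"
    "\<And>c g. c \<in> V2 \<Longrightarrow> (\<Sum>a\<in>V2. A a c * g a) = (\<Sum>k<d2. g (\<nu> c k) / real d2)"
    using ex by metis
  show ?thesis
    unfolding Z_def[symmetric] poincare_const_def
  proof (intro conjI allI impI)
    show "0 < \<gamma>1 * \<gamma>2 * \<gamma>3" using pos by simp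
    fix x y assume x: "x ` verts Z \<subseteq> X" and y: "y ` verts Z \<subseteq> X"
    have vZ: "verts Z = V1 \<times> V2" by (simp add: Z_def zigzag_def V1_def V2_def)
    have xX: "x (u, a) \<in> X" and yX: "y (u, a) \<in> X" if "u \<in> V1" "a \<in> V2" for u a
      using x y that by (auto simp: vZ)
    \<comment> \<open>An edge copy records its target, so a function of the target vertex is also a
      function of the edge, the form \<open>sum_edges_le\<close> expects.\<close>
    have copy_target: "fst (snd e) = v" if "e \<in> edge_copies G1 u v" for u v e
      using that by (auto simp: edge_copies_def)
    let ?k = "\<lambda>u a v b. K (x (u, a)) (y (v, b))"

    \<comment> \<open>For fixed \<open>a\<close> and \<open>b\<close> this is the inequality for
      \<open>G1\<close>, whose degree is \<open>d1\<close>; multiplicities are unfolded into sums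
      over edge copies.\<close>
    have first: "(\<Sum>a\<in>V2. \<Sum>b\<in>V2. \<Sum>u\<in>V1. \<Sum>v\<in>V1. ?k u a v b)
        \<le> \<gamma>1 * n1 / d1 * (\<Sum>u\<in>V1. \<Sum>b\<in>V2. \<Sum>v\<in>V1. \<Sum>e\<in>edge_copies G1 u v. \<Sum>a\<in>V2. ?k u a v b)"
    proof -
      have "(\<Sum>u\<in>V1. \<Sum>v\<in>V1. ?k u a v b)
          \<le> \<gamma>1 * n1 / d1 * (\<Sum>u\<in>V1. \<Sum>v\<in>V1. \<Sum>e\<in>edge_copies G1 u v. ?k u a v b)"
        if ab: "a \<in> V2" "b \<in> V2" for a b
      proof -
        have "(\<Sum>u\<in>V1. \<Sum>v\<in>V1. ?k u a v b)
          \<le> \<gamma>1 * n1 * (\<Sum>u\<in>V1. \<Sum>v\<in>V1. norm_adj G1 u v * ?k u a v b)"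
          using poincare_constD[OF p1, of "\<lambda>u. x (u, a)" "\<lambda>v. y (v, b)"] xX yX ab
          by (simp add: V1_def n1_def)
        also have "(\<Sum>u\<in>V1. \<Sum>v\<in>V1. norm_adj G1 u v * ?k u a v b)
          = (\<Sum>u\<in>V1. \<Sum>v\<in>V1. \<Sum>e\<in>edge_copies G1 u v. ?k u a v b) / d1"
          by (simp add: A1 card_copies sum_divide_distrib)
        finally show ?thesis by simp
      qed
      then have "(\<Sum>a\<in>V2. \<Sum>b\<in>V2. \<Sum>u\<in>V1. \<Sum>v\<in>V1. ?k u a v b)
        \<le> \<gamma>1 * n1 / d1 * (\<Sum>a\<in>V2. \<Sum>b\<in>V2. \<Sum>u\<in>V1. \<Sum>v\<in>V1. \<Sum>e\<in>edge_copies G1 u v. ?k u a v b)"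
        unfolding sum_distrib_left[of _ _ V2] by (intro sum_mono)
      also have "(\<Sum>a\<in>V2. \<Sum>b\<in>V2. \<Sum>u\<in>V1. \<Sum>v\<in>V1. \<Sum>e\<in>edge_copies G1 u v. ?k u a v b)
        = (\<Sum>u\<in>V1. \<Sum>b\<in>V2. \<Sum>v\<in>V1. \<Sum>e\<in>edge_copies G1 u v. \<Sum>a\<in>V2. ?k u a v b)"
        by (subst sum.swap) (simp only: sum.swap[of _ V1 V2] sum.swap[of _ "edge_copies _ _ _" V2])
      finally show ?thesis .
    qed

    have second: "(\<Sum>v\<in>V1. \<Sum>e\<in>edge_copies G1 u v. \<Sum>a\<in>V2. ?k u a v b)
      \<le> \<gamma>2 * d1 * (\<Sum>v\<in>V1. \<Sum>e\<in>edge_copies G1 u v. \<Sum>a\<in>V2. A a (lab u e) * ?k u a v b)"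
      if "u \<in> V1" "b \<in> V2" for u b
      using sum_edges_le[OF p2[folded V2_def A_def], of u "\<lambda>a. x (u, a)" "\<lambda>e. y (fst (snd e), b)"]
        that xX yX by (simp add: copy_target cong: sum.cong_simp)

    have third: "(\<Sum>u\<in>V1. \<Sum>e\<in>edge_copies G1 u v. \<Sum>b\<in>V2. \<Sum>a\<in>V2. A a (lab u e) * ?k u a v b)
      \<le> \<gamma>3 * d1 * (\<Sum>u\<in>V1. \<Sum>e\<in>edge_copies G1 u v. \<Sum>b\<in>V2. \<Sum>a\<in>V2.
          A a (lab u e) * A b (lab v (bar e)) * ?k u a v b)"
      if v: "v \<in> V1" for v
    proof -
      \<comment> \<open>Here \<open>e\<close> is a reversed edge from \<open>v\<close> to
        \<open>u\<close>: \<open>fst (snd e)\<close> is \<open>u\<close>, \<open>bar e\<close> is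
        the original edge, and \<open>f k e\<close> is \<open>x\<close> at the \<open>k\<close>-th
        neighbour of its label at \<open>u\<close>.\<close>
      define f where "f k e = x (fst (snd e), \<nu> (lab (fst (snd e)) (bar e)) k)" for k e
      \<comment> \<open>As before, \<open>B\<close> is 1 for the left side of \<open>third\<close>
        and \<open>A\<close> for its right side. Reversing the edges makes \<open>v\<close> their
        common source.\<close>
      have eq: "(\<Sum>u\<in>V1. \<Sum>e\<in>edge_copies G1 u v. \<Sum>b\<in>V2. \<Sum>a\<in>V2.
            A a (lab u e) * B b (lab v (bar e)) * ?k u a v b)
          = (\<Sum>k<d2. (\<Sum>u\<in>V1. \<Sum>e\<in>edge_copies G1 v u. \<Sum>b\<in>V2.
              B b (lab v e) * K (y (v, b)) (f k e)) / real d2)" for B :: "'b \<Rightarrow> 'b \<Rightarrow> real"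
      proof -
        have "(\<Sum>e\<in>edge_copies G1 u v. \<Sum>b\<in>V2. \<Sum>a\<in>V2.
            A a (lab u e) * B b (lab v (bar e)) * ?k u a v b)
          = (\<Sum>e\<in>edge_copies G1 v u. \<Sum>b\<in>V2. \<Sum>k<d2.
              B b (lab v e) * K (y (v, b)) (f k e) / real d2)" if u: "u \<in> V1" for u
        proof -
          have "(\<Sum>e\<in>edge_copies G1 u v. \<Sum>b\<in>V2. \<Sum>a\<in>V2.
              A a (lab u e) * B b (lab v (bar e)) * ?k u a v b)
            = (\<Sum>e\<in>edge_copies G1 v u. \<Sum>b\<in>V2. \<Sum>a\<in>V2.
              A a (lab u (bar e)) * B b (lab v (bar (bar e))) * ?k u a v b)"
            by (rule sum.reindex_bij_betw[OF bar_copies[OF u v], symmetric])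
          also have "\<dots> = (\<Sum>e\<in>edge_copies G1 v u. \<Sum>b\<in>V2. \<Sum>k<d2.
              B b (lab v e) * K (y (v, b)) (f k e) / real d2)"
          proof (intro sum.cong refl)
            fix e b assume e: "e \<in> edge_copies G1 v u" and b: "b \<in> V2"
            have c: "lab u (bar e) \<in> V2"
              using lab_in[OF u v] bij_betwE[OF bar_copies[OF u v]] e by blast
            have "(\<Sum>a\<in>V2. A a (lab u (bar e)) * B b (lab v (bar (bar e))) * ?k u a v b)
              = (\<Sum>a\<in>V2. A a (lab u (bar e)) * (B b (lab v e) * ?k u a v b))"
              using bar_bar[OF v u e] by (simp add: mult_ac)
            also have "\<dots> = (\<Sum>k<d2. B b (lab v e) * ?k u (\<nu> (lab u (bar e)) k) v b / real d2)"
              by (rule \<nu>(2)[OF c])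
            also have "\<dots> = (\<Sum>k<d2. B b (lab v e) * K (y (v, b)) (f k e) / real d2)"
            proof (intro sum.cong refl)
              \<comment> \<open>Symmetry of \<open>K\<close>, valid for points of \<open>X\<close>,
                puts \<open>y\<close> first: \<open>v\<close> is now the vertex whose labels are
                used.\<close>
              fix k assume "k \<in> {..<d2}"
              then have "x (u, \<nu> (lab u (bar e)) k) \<in> X" "y (v, b) \<in> X"
                using xX yX u v b c \<nu>(1) by auto
              with K show "B b (lab v e) * ?k u (\<nu> (lab u (bar e)) k) v b / real d2
                = B b (lab v e) * K (y (v, b)) (f k e) / real d2"
                by (simp add: kernel_on_def f_def copy_target[OF e])
            qed
            finally show "(\<Sum>a\<in>V2. A a (lab u (bar e)) * B b (lab v (bar (bar e))) * ?k u a v b)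
              = (\<Sum>k<d2. B b (lab v e) * K (y (v, b)) (f k e) / real d2)" .
          qed
          finally show ?thesis .
        qed
        then have "(\<Sum>u\<in>V1. \<Sum>e\<in>edge_copies G1 u v. \<Sum>b\<in>V2. \<Sum>a\<in>V2.
            A a (lab u e) * B b (lab v (bar e)) * ?k u a v b)
          = (\<Sum>u\<in>V1. \<Sum>e\<in>edge_copies G1 v u. \<Sum>b\<in>V2. \<Sum>k<d2.
              B b (lab v e) * K (y (v, b)) (f k e) / real d2)" by simp
        also have "\<dots> = (\<Sum>k<d2. \<Sum>u\<in>V1. \<Sum>e\<in>edge_copies G1 v u. \<Sum>b\<in>V2.
              B b (lab v e) * K (y (v, b)) (f k e) / real d2)"
          by (simp only: sum.swap[of _ _ "{..<d2}"])
        finally show ?thesis by (simp only: sum_divide_distrib)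
      qed
      have "(\<Sum>u\<in>V1. \<Sum>e\<in>edge_copies G1 v u. \<Sum>b\<in>V2. K (y (v, b)) (f k e))
        \<le> \<gamma>3 * d1 * (\<Sum>u\<in>V1. \<Sum>e\<in>edge_copies G1 v u. \<Sum>b\<in>V2.
            A b (lab v e) * K (y (v, b)) (f k e))" if k: "k < d2" for k
      proof (rule sum_edges_le[OF p3[folded V2_def A_def] v])
        show "y (v, b) \<in> X" if "b \<in> V2" for b using yX v that .
        fix u e assume u: "u \<in> V1" and e: "e \<in> edge_copies G1 v u"
        have "lab u (bar e) \<in> V2"
          using lab_in[OF u v] bij_betwE[OF bar_copies[OF u v]] e by blast
        then show "f k e \<in> X" using xX u k \<nu>(1) by (simp add: f_def copy_target[OF e])
      qed
      then have "(\<Sum>k<d2. (\<Sum>u\<in>V1. \<Sum>e\<in>edge_copies G1 v u. \<Sum>b\<in>V2. K (y (v, b)) (f k e)) / real d2)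
        \<le> (\<Sum>k<d2. \<gamma>3 * d1 * (\<Sum>u\<in>V1. \<Sum>e\<in>edge_copies G1 v u. \<Sum>b\<in>V2.
            A b (lab v e) * K (y (v, b)) (f k e)) / real d2)"
        by (intro sum_mono divide_right_mono) auto
      then show ?thesis
        using eq[of "\<lambda>_ _. 1"] eq[of A] by (simp add: sum_distrib_left)
    qed

    show "(\<Sum>i\<in>verts Z. \<Sum>j\<in>verts Z. K (x i) (y j)) \<le> \<gamma>1 * \<gamma>2 * \<gamma>3 * real (card (verts Z)) *
      (\<Sum>i\<in>verts Z. \<Sum>j\<in>verts Z. norm_adj Z i j * K (x i) (y j))"
    proof -
      \<comment> \<open>\<open>second\<close> fixes \<open>u\<close> and \<open>b\<close>, whereas
        \<open>third\<close> fixes only \<open>v\<close>; the sums are reordered in between.\<close>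
      have swap: "(\<Sum>u\<in>V1. \<Sum>b\<in>V2. \<Sum>v\<in>V1. \<Sum>e\<in>edge_copies G1 u v. \<Sum>a\<in>V2. F u v e a b)
        = (\<Sum>v\<in>V1. \<Sum>u\<in>V1. \<Sum>e\<in>edge_copies G1 u v. \<Sum>b\<in>V2. \<Sum>a\<in>V2. F u v e a b)"
        for F :: "'a \<Rightarrow> 'a \<Rightarrow> 'a \<times> 'a \<times> nat \<Rightarrow> 'b \<Rightarrow> 'b \<Rightarrow> real"
      proof -
        have "(\<Sum>u\<in>V1. \<Sum>b\<in>V2. \<Sum>v\<in>V1. \<Sum>e\<in>edge_copies G1 u v. \<Sum>a\<in>V2. F u v e a b)
          = (\<Sum>u\<in>V1. \<Sum>v\<in>V1. \<Sum>b\<in>V2. \<Sum>e\<in>edge_copies G1 u v. \<Sum>a\<in>V2. F u v e a b)"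
          by (intro sum.cong refl sum.swap)
        also have "\<dots> = (\<Sum>u\<in>V1. \<Sum>v\<in>V1. \<Sum>e\<in>edge_copies G1 u v. \<Sum>b\<in>V2. \<Sum>a\<in>V2. F u v e a b)"
          by (intro sum.cong refl sum.swap)
        also have "\<dots> = (\<Sum>v\<in>V1. \<Sum>u\<in>V1. \<Sum>e\<in>edge_copies G1 u v. \<Sum>b\<in>V2. \<Sum>a\<in>V2. F u v e a b)"
          by (rule sum.swap)
        finally show ?thesis .
      qed
      have "(\<Sum>i\<in>verts Z. \<Sum>j\<in>verts Z. K (x i) (y j))
        = (\<Sum>u\<in>V1. \<Sum>a\<in>V2. \<Sum>v\<in>V1. \<Sum>b\<in>V2. ?k u a v b)"
        by (simp add: vZ sum.cartesian_product')
      also have "\<dots> = (\<Sum>a\<in>V2. \<Sum>u\<in>V1. \<Sum>v\<in>V1. \<Sum>b\<in>V2. ?k u a v b)"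
        by (rule sum.swap)
      also have "\<dots> = (\<Sum>a\<in>V2. \<Sum>b\<in>V2. \<Sum>u\<in>V1. \<Sum>v\<in>V1. ?k u a v b)"
        by (simp only: sum.swap[of _ V2 V1])
      also note first
      also have "(\<Sum>u\<in>V1. \<Sum>b\<in>V2. \<Sum>v\<in>V1. \<Sum>e\<in>edge_copies G1 u v. \<Sum>a\<in>V2. ?k u a v b)
        \<le> (\<Sum>u\<in>V1. \<Sum>b\<in>V2. \<gamma>2 * d1 *
          (\<Sum>v\<in>V1. \<Sum>e\<in>edge_copies G1 u v. \<Sum>a\<in>V2. A a (lab u e) * ?k u a v b))"
        by (intro sum_mono second)
      also have "\<dots> = \<gamma>2 * d1 *
          (\<Sum>v\<in>V1. \<Sum>u\<in>V1. \<Sum>e\<in>edge_copies G1 u v. \<Sum>b\<in>V2. \<Sum>a\<in>V2. A a (lab u e) * ?k u a v b)"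
        by (simp only: swap flip: sum_distrib_left)
      also have "(\<Sum>v\<in>V1. \<Sum>u\<in>V1. \<Sum>e\<in>edge_copies G1 u v. \<Sum>b\<in>V2. \<Sum>a\<in>V2. A a (lab u e) * ?k u a v b)
        \<le> (\<Sum>v\<in>V1. \<gamma>3 * d1 * (\<Sum>u\<in>V1. \<Sum>e\<in>edge_copies G1 u v. \<Sum>b\<in>V2. \<Sum>a\<in>V2.
          A a (lab u e) * A b (lab v (bar e)) * ?k u a v b))"
        by (intro sum_mono third)
      also have "\<dots> = \<gamma>3 * d1 * (\<Sum>v\<in>V1. \<Sum>u\<in>V1. \<Sum>e\<in>edge_copies G1 u v. \<Sum>b\<in>V2. \<Sum>a\<in>V2.
          A a (lab u e) * A b (lab v (bar e)) * ?k u a v b)"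
        by (simp only: sum_distrib_left)
      also have "(\<Sum>v\<in>V1. \<Sum>u\<in>V1. \<Sum>e\<in>edge_copies G1 u v. \<Sum>b\<in>V2. \<Sum>a\<in>V2.
          A a (lab u e) * A b (lab v (bar e)) * ?k u a v b)
        = (\<Sum>u\<in>V1. \<Sum>a\<in>V2. \<Sum>v\<in>V1. \<Sum>b\<in>V2. norm_adj Z (u, a) (v, b) * ?k u a v b)"
      proof -
        have "(\<Sum>u\<in>V1. \<Sum>a\<in>V2. \<Sum>v\<in>V1. \<Sum>b\<in>V2. norm_adj Z (u, a) (v, b) * ?k u a v b)
          = (\<Sum>u\<in>V1. \<Sum>a\<in>V2. \<Sum>v\<in>V1. \<Sum>b\<in>V2. \<Sum>e\<in>edge_copies G1 u v.
            A a (lab u e) * A b (lab v (bar e)) * ?k u a v b)"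
          by (simp add: AZ sum_distrib_right)
        also have "\<dots> = (\<Sum>u\<in>V1. \<Sum>v\<in>V1. \<Sum>a\<in>V2. \<Sum>b\<in>V2. \<Sum>e\<in>edge_copies G1 u v.
            A a (lab u e) * A b (lab v (bar e)) * ?k u a v b)"
          by (intro sum.cong refl sum.swap)
        also have "\<dots> = (\<Sum>v\<in>V1. \<Sum>u\<in>V1. \<Sum>a\<in>V2. \<Sum>b\<in>V2. \<Sum>e\<in>edge_copies G1 u v.
            A a (lab u e) * A b (lab v (bar e)) * ?k u a v b)"
          by (rule sum.swap)
        also have "\<dots> = (\<Sum>v\<in>V1. \<Sum>u\<in>V1. \<Sum>b\<in>V2. \<Sum>a\<in>V2. \<Sum>e\<in>edge_copies G1 u v.
            A a (lab u e) * A b (lab v (bar e)) * ?k u a v b)"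
          by (intro sum.cong refl sum.swap)
        also have "\<dots> = (\<Sum>v\<in>V1. \<Sum>u\<in>V1. \<Sum>e\<in>edge_copies G1 u v. \<Sum>b\<in>V2. \<Sum>a\<in>V2.
            A a (lab u e) * A b (lab v (bar e)) * ?k u a v b)"
          by (simp only: sum.swap[of _ "edge_copies _ _ _" V2])
        finally show ?thesis ..
      qed
      \<comment> \<open>One factor \<open>d1\<close> cancels the degree of \<open>G1\<close>; the
        remaining \<open>n1 * d1\<close> is the number of vertices of the product.\<close>
      also have "\<gamma>1 * n1 / d1 * (\<gamma>2 * d1 * (\<gamma>3 * d1 *
          (\<Sum>u\<in>V1. \<Sum>a\<in>V2. \<Sum>v\<in>V1. \<Sum>b\<in>V2. norm_adj Z (u, a) (v, b) * ?k u a v b)))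
        = \<gamma>1 * \<gamma>2 * \<gamma>3 * real (card (verts Z)) *
          (\<Sum>i\<in>verts Z. \<Sum>j\<in>verts Z. norm_adj Z i j * K (x i) (y j))"
        by (simp add: vZ sum.cartesian_product' card_cartesian_product n1_def d1_def)
      \<comment> \<open>The chain replaced sums under multiplication by constants; nonnegativity of
        these discharges the monotonicity conditions.\<close>
      finally show ?thesis
        using pos nonneg by (simp add: mult_left_mono divide_right_mono)
    qed
  qed
qed

section \<open>Passing to infima\<close>

theorem theorem1p3:
  fixes G1 :: "'a mgraph" and G2 :: "'b mgraph"
    and n1 d1 d2 :: nat
    and bar :: "'a \<times> 'a \<times> nat \<Rightarrow> 'a \<times> 'a \<times> nat"
    and lab :: "'a \<Rightarrow> 'a \<times> 'a \<times> nat \<Rightarrow> 'b"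
    and X :: "'x set" and K :: "'x \<Rightarrow> 'x \<Rightarrow> real"
  assumes "multigraph G1" and "card (verts G1) = n1" and "regular d1 G1"
    and "multigraph G2" and "card (verts G2) = d1" and "regular d2 G2"
    and "edge_pairing G1 bar" and "labeling G1 (verts G2) lab"
    and "kernel_on X K"
  shows "graph_gamma_plus (zigzag G1 G2 bar lab) X K
           \<le> graph_gamma_plus G1 X K * (graph_gamma_plus G2 X K)\<^sup>2"
proof -
  define g where "g = graph_gamma_plus (zigzag G1 G2 bar lab) X K"
  define P1 where "P1 = ennreal ` {\<gamma>. poincare_const (verts G1) (norm_adj G1) X K \<gamma>}"
  define P2 where "P2 = ennreal ` {\<gamma>. poincare_const (verts G2) (norm_adj G2) X K \<gamma>}"
  have fin: "finite (verts G1)" "finite (verts G2)"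
    using assms by (auto simp: multigraph_def)
  then have finZ: "finite (verts (zigzag G1 G2 bar lab))" by (simp add: zigzag_def)
  have g1: "graph_gamma_plus G1 X K = Inf P1" and g2: "graph_gamma_plus G2 X K = Inf P2"
    using fin by (simp_all add: graph_gamma_plus_def gamma_plus_eq_Inf P1_def P2_def)
  show ?thesis
  proof (cases "Inf P1 = 0 \<or> Inf P2 = 0")
    case True
    \<comment> \<open>Separate because in \<^typ>\<open>ennreal\<close> the right-hand side is \<open>0\<close> even if the other factor is \<open>\<infinity>\<close>.\<close>
    then have "verts G1 = {} \<or> verts G2 = {} \<or> (\<forall>x\<in>X. \<forall>y\<in>X. K x y = 0)"
      unfolding g1[symmetric] g2[symmetric] graph_gamma_plus_def
      using gamma_plus_eq_0D[OF fin(1) assms(9)] gamma_plus_eq_0D[OF fin(2) assms(9)] by blast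
    then have "g = 0"
      unfolding g_def graph_gamma_plus_def
      by (intro gamma_plus_eq_0I[OF finZ]) (auto simp: zigzag_def)
    then show ?thesis by (simp add: g_def)
  next
    case False
    have pos: "c \<noteq> 0 \<and> c \<noteq> top" if "c \<in> P2" for c
      using that by (auto simp: P2_def dest: poincare_const_pos)
    have le: "g \<le> a * (b * c)" if abc: "a \<in> P1" "b \<in> P2" "c \<in> P2" for a b c
    proof -
      obtain \<gamma>1 \<gamma>2 \<gamma>3 where *: "a = ennreal \<gamma>1" "poincare_const (verts G1) (norm_adj G1) X K \<gamma>1"
        "b = ennreal \<gamma>2" "poincare_const (verts G2) (norm_adj G2) X K \<gamma>2"
        "c = ennreal \<gamma>3" "poincare_const (verts G2) (norm_adj G2) X K \<gamma>3"
        using abc by (auto simp: P1_def P2_def)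
      have "g \<le> ennreal (\<gamma>1 * \<gamma>2 * \<gamma>3)"
        unfolding g_def graph_gamma_plus_def
        using assms * by (intro gamma_plus_le[OF finZ] poincare_const_zigzag) auto
      then show ?thesis
        using *(2,4,6)[THEN poincare_const_pos] by (simp add: * ennreal_mult mult.assoc)
    qed
    \<comment> \<open>The infima are taken one factor at a time. First the cofactor
      \<open>b * c\<close> is positive and finite; in the later two rounds it contains
      \<open>Inf P1\<close>, possibly \<open>top\<close>, which is harmless because
      \<open>Inf P2\<close> is nonzero.\<close>
    have "g \<le> Inf P1 * (b * c)" if "b \<in> P2" "c \<in> P2" for b c
      using le that pos[of b] pos[of c] by (intro le_Inf_mult_ennreal) (auto simp: ennreal_mult_eq_top_iff)
    then have "g \<le> b * (Inf P1 * c)" if "b \<in> P2" "c \<in> P2" for b c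
      using that by (simp add: mult_ac)
    then have "g \<le> Inf P2 * (Inf P1 * c)" if "c \<in> P2" for c
      using that pos[of c] False by (intro le_Inf_mult_ennreal) auto
    then have "g \<le> c * (Inf P1 * Inf P2)" if "c \<in> P2" for c
      using that by (simp add: mult_ac)
    then have "g \<le> Inf P2 * (Inf P1 * Inf P2)"
      using False by (intro le_Inf_mult_ennreal) auto
    then show ?thesis by (simp add: g_def g1 g2 power2_eq_square mult_ac)
  qed
qed

end
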